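(* Let $k \geq 3$ be an integer and let $n\ge 1$. If $\mathcal{P}$ is an $n$-polytope whose facet graph is not $(k-1)$-colorable, then there is no $(n+1)$-polytope $\mathcal{Q}$ with $k$ facets (in total), each isomorphic to $\mathcal{P}$, such that $\mathcal{Q}$ is $(n-2,n)$-flat.
   Context: For an integer $n\ge 1$, an $n$-pre-maniplex is an $n$-regular simple graph (its nodes are called flags) whose edges are colored with $0,1,\ldots,n-1$ so that each flag is incident to exactly one edge of each color; $\Phi^i$ denotes the other endpoint of the edge of color $i$ at the flag $\Phi$. An $n$-maniplex is a connected $n$-pre-maniplex in which $(\Phi^i)^j=(\Phi^j)^i$ for every flag $\Phi$ and all colors $i,j$ with $|i-j|>1$. An $n$-polytope (identified with its flag graph) is an $n$-maniplex satisfying the Path Intersection Property: for every pair of flags $\Phi,\Psi$ and all colors $i\le j$, if there is a path from $\Phi$ to $\Psi$ using only colors in $\{i,\ldots,n-1\}$ and another path from $\Phi$ to $\Psi$ using only colors in $\{0,\ldots,j\}$, then there is a path from $\Phi$ to $\Psi$ using only colors in $\{i,\ldots,j\}$. The $i$-faces of an $n$-maniplex are the connected components of the graph obtained by deleting all edges of color $i$; the $(n-1)$-faces are called facets. Two faces are incident if they have a flag in common. A facet of an $(n+1)$-polytope is a connected graph with edge colors $0,\ldots,n-1$, and it is isomorphic to $\mathcal{P}$ if there is a color-preserving graph isomorphism to $\mathcal{P}$. The facet graph of an $n$-polytope $\mathcal{P}$ is the simple graph whose nodes are the facets of $\mathcal{P}$, two nodes being adjacent if there is an edge of color $n-1$ in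 $\mathcal{P}$ between the corresponding facets. A graph is $(k-1)$-colorable if it has a proper vertex coloring with at most $k-1$ colors. A polytope is $(i,j)$-flat if every $i$-face is incident to every $j$-face; equivalently, for every flag $\Phi$ and every $j$-face there is a path from $\Phi$ to some flag in that $j$-face that uses no edge of color $i$. (If $i=-1$, no edges are deleted, so the whole polytope is the only $(-1)$-face.) *)

theory Defs
  imports Main
begin

section \<open>Graphs\<close>

text \<open>Edges are sets of nodes. Graphs may be infinite.\<close>

record 'a graph =
  nodes :: "'a set"
  edges :: "'a set set"

definition simple_graph :: "('a, 'b) graph_scheme \<Rightarrow> bool" where
  "simple_graph G \<longleftrightarrow> (\<forall>e\<in>edges G. e \<subseteq> nodes G \<and> card e = 2)"

definition regular :: "nat \<Rightarrow> ('a, 'b) graph_scheme \<Rightarrow> bool" where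
  "regular d G \<longleftrightarrow>
     (\<forall>x\<in>nodes G. finite {e \<in> edges G. x \<in> e} \<and> card {e \<in> edges G. x \<in> e} = d)"

definition adj :: "('a, 'b) graph_scheme \<Rightarrow> ('a \<times> 'a) set" where
  "adj G = {(x, y). {x, y} \<in> edges G}"

definition has_path :: "('a, 'b) graph_scheme \<Rightarrow> 'a \<Rightarrow> 'a \<Rightarrow> bool" where
  "has_path G x y \<longleftrightarrow> x \<in> nodes G \<and> y \<in> nodes G \<and> (x, y) \<in> (adj G)\<^sup>*"

definition connected_graph :: "('a, 'b) graph_scheme \<Rightarrow> bool" where
  "connected_graph G \<longleftrightarrow> nodes G \<noteq> {} \<and> (\<forall>x\<in>nodes G. \<forall>y\<in>nodes G. has_path G x y)"

definition induced_subgraph ::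
    "('a, 'b) graph_scheme \<Rightarrow> 'a set \<Rightarrow> ('a, 'b) graph_scheme" where
  "induced_subgraph G C = G\<lparr>nodes := C, edges := {e \<in> edges G. e \<subseteq> C}\<rparr>"

definition components :: "('a, 'b) graph_scheme \<Rightarrow> ('a, 'b) graph_scheme set" where
  "components G = (\<lambda>x. induced_subgraph G {y. has_path G x y}) ` nodes G"

definition colorable :: "nat \<Rightarrow> ('a, 'b) graph_scheme \<Rightarrow> bool" where
  "colorable m G \<longleftrightarrow>
     (\<exists>c :: 'a \<Rightarrow> nat. (\<forall>x\<in>nodes G. c x < m) \<and>
        (\<forall>x y. {x, y} \<in> edges G \<longrightarrow> c x \<noteq> c y))"

section \<open>Edge-colored graphs\<close>

text \<open>Only the values of \<open>color\<close> on edges are meaningful.\<close>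

record 'a colored_graph = "'a graph" +
  color :: "'a set \<Rightarrow> nat"

definition restrict_colors :: "nat set \<Rightarrow> 'a colored_graph \<Rightarrow> 'a colored_graph" where
  "restrict_colors I G = G\<lparr>edges := {e \<in> edges G. color G e \<in> I}\<rparr>"

definition has_path_using :: "nat set \<Rightarrow> 'a colored_graph \<Rightarrow> 'a \<Rightarrow> 'a \<Rightarrow> bool" where
  "has_path_using I G x y \<longleftrightarrow> has_path (restrict_colors I G) x y"

definition isomorphic :: "'a colored_graph \<Rightarrow> 'b colored_graph \<Rightarrow> bool" where
  "isomorphic G H \<longleftrightarrow>
     (\<exists>f. bij_betw f (nodes G) (nodes H) \<and> edges H = (\<lambda>e. f ` e) ` edges G \<and>
        (\<forall>e\<in>edges G. color H (f ` e) = color G e))"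

section \<open>Maniplexes and polytopes\<close>

definition pre_maniplex :: "nat \<Rightarrow> 'a colored_graph \<Rightarrow> bool" where
  "pre_maniplex n M \<longleftrightarrow> simple_graph M \<and> regular n M \<and>
     (\<forall>e\<in>edges M. color M e < n) \<and>
     (\<forall>\<Phi>\<in>nodes M. \<forall>i<n. \<exists>!e. e \<in> edges M \<and> \<Phi> \<in> e \<and> color M e = i)"

definition nbr :: "'a colored_graph \<Rightarrow> nat \<Rightarrow> 'a \<Rightarrow> 'a" where
  "nbr M i \<Phi> = (THE \<Psi>. {\<Phi>, \<Psi>} \<in> edges M \<and> color M {\<Phi>, \<Psi>} = i)"

definition maniplex :: "nat \<Rightarrow> 'a colored_graph \<Rightarrow> bool" where
  "maniplex n M \<longleftrightarrow> pre_maniplex n M \<and> connected_graph M \<and>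
     (\<forall>\<Phi>\<in>nodes M. \<forall>i<n. \<forall>j<n. \<bar>int i - int j\<bar> > 1 \<longrightarrow>
        nbr M j (nbr M i \<Phi>) = nbr M i (nbr M j \<Phi>))"

definition path_intersection_property :: "nat \<Rightarrow> 'a colored_graph \<Rightarrow> bool" where
  "path_intersection_property n M \<longleftrightarrow>
     (\<forall>\<Phi>\<in>nodes M. \<forall>\<Psi>\<in>nodes M. \<forall>i j. i \<le> j \<and> j < n \<longrightarrow>
        has_path_using {i..<n} M \<Phi> \<Psi> \<longrightarrow> has_path_using {0..j} M \<Phi> \<Psi> \<longrightarrow>
        has_path_using {i..j} M \<Phi> \<Psi>)"

definition polytope :: "nat \<Rightarrow> 'a colored_graph \<Rightarrow> bool" where
  "polytope n M \<longleftrightarrow> maniplex n M \<and> path_intersection_property n M"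

text \<open>Face indices are integers so that \<open>-1\<close> is allowed: no edge is deleted in that case, and
  the only \<open>-1\<close>-face of a connected graph is the graph itself.\<close>

definition faces :: "int \<Rightarrow> 'a colored_graph \<Rightarrow> 'a colored_graph set" where
  "faces i M = components (restrict_colors {c. int c \<noteq> i} M)"

definition facets :: "nat \<Rightarrow> 'a colored_graph \<Rightarrow> 'a colored_graph set" where
  "facets n M = faces (int n - 1) M"

definition incident :: "'a colored_graph \<Rightarrow> 'a colored_graph \<Rightarrow> bool" where
  "incident F G \<longleftrightarrow> nodes F \<inter> nodes G \<noteq> {}"

definition flat :: "int \<Rightarrow> int \<Rightarrow> 'a colored_graph \<Rightarrow> bool" where
  "flat i j M \<longleftrightarrow> (\<forall>F\<in>faces i M. \<forall>G\<in>faces j M. incident F G)"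

definition facet_graph :: "nat \<Rightarrow> 'a colored_graph \<Rightarrow> 'a colored_graph graph" where
  "facet_graph n M =
     \<lparr>nodes = facets n M,
      edges = {{F, G} | F G. F \<in> facets n M \<and> G \<in> facets n M \<and> F \<noteq> G \<and>
        (\<exists>\<Phi>\<in>nodes F. \<exists>\<Psi>\<in>nodes G. {\<Phi>, \<Psi>} \<in> edges M \<and> int (color M {\<Phi>, \<Psi>}) = int n - 1)}\<rparr>"

end

theory Submission
  imports Defs
begin

text \<open>Cross a fixed facet \<open>F\<close> of \<open>Q\<close>, identified with \<open>P\<close>, by color \<open>n\<close>. As \<open>n\<close> commutes with all
  colors below \<open>n - 1\<close>, each facet of \<open>P\<close> leads in this way to a single facet of \<open>Q\<close>, and path
  intersection shows that it is never \<open>F\<close>: this colors the facets of \<open>P\<close> with \<open>k - 1\<close> colors.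
  If two facets of \<open>P\<close> adjacent at a flag \<open>\<Phi>\<close> received the same color, path intersection would make
  the colors \<open>n - 1\<close> and \<open>n\<close> commute at \<open>\<Phi>\<close>. The \<open>(n-2)\<close>-face of \<open>\<Phi>\<close> would then meet only two
  facets of \<open>Q\<close>, contradicting flatness because \<open>k \<ge> 3\<close>.\<close>

section \<open>Neighbours and paths in pre-maniplexes\<close>

lemma nbr_eqI:
  assumes "pre_maniplex m M" "{x, y} \<in> edges M" "color M {x, y} = i"
  shows "nbr M i x = y"
proof -
  have s: "{x, y} \<subseteq> nodes M" "i < m"
    using assms by (auto simp: pre_maniplex_def simple_graph_def)
  then have ex: "\<exists>!e. e \<in> edges M \<and> x \<in> e \<and> color M e = i"
    using assms(1) by (auto simp: pre_maniplex_def)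
  show ?thesis unfolding nbr_def
  proof (rule the_equality)
    show "{x, y} \<in> edges M \<and> color M {x, y} = i" using assms by simp
  next
    fix z assume "{x, z} \<in> edges M \<and> color M {x, z} = i"
    then have "{x, z} = {x, y}" using ex assms by (metis insertI1)
    then show "z = y" by (auto simp: doubleton_eq_iff)
  qed
qed

lemma nbr_edge:
  assumes "pre_maniplex m M" "x \<in> nodes M" "i < m"
  shows "{x, nbr M i x} \<in> edges M" "color M {x, nbr M i x} = i"
proof -
  obtain e where e: "e \<in> edges M" "x \<in> e" "color M e = i"
    using assms unfolding pre_maniplex_def by blast
  then have "card e = 2" using assms(1) by (auto simp: pre_maniplex_def simple_graph_def)
  then obtain y where y: "e = {x, y}" using e(2) by (auto simp: card_2_iff)
  then have "nbr M i x = y" using nbr_eqI[OF assms(1)] e by auto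
  then show "{x, nbr M i x} \<in> edges M" "color M {x, nbr M i x} = i" using e y by auto
qed

lemma nbr_in_nodes:
  assumes "pre_maniplex m M" "x \<in> nodes M" "i < m"
  shows "nbr M i x \<in> nodes M"
  using nbr_edge[OF assms] assms(1) by (auto simp: pre_maniplex_def simple_graph_def)

lemma nbr_neq:
  assumes "pre_maniplex m M" "x \<in> nodes M" "i < m"
  shows "nbr M i x \<noteq> x"
proof
  assume "nbr M i x = x"
  then have "card {x} = 2"
    using nbr_edge[OF assms] assms(1) by (auto simp: pre_maniplex_def simple_graph_def)
  then show False by simp
qed

lemma nbr_nbr:
  assumes "pre_maniplex m M" "x \<in> nodes M" "i < m"
  shows "nbr M i (nbr M i x) = x"
  using nbr_edge[OF assms] by (intro nbr_eqI[OF assms(1)]) (auto simp: insert_commute)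

lemma nbr_color_inj:
  assumes "pre_maniplex m M" "x \<in> nodes M" "i < m" "j < m" "nbr M i x = nbr M j x"
  shows "i = j"
  using nbr_edge(2)[OF assms(1,2,3)] nbr_edge(2)[OF assms(1,2,4)] assms(5) by metis

section \<open>Paths with prescribed edge colors\<close>

lemma has_path_using_refl: "x \<in> nodes M \<Longrightarrow> has_path_using I M x x"
  by (simp add: has_path_using_def has_path_def restrict_colors_def)

lemma has_path_using_trans:
  "has_path_using I M x y \<Longrightarrow> has_path_using I M y z \<Longrightarrow> has_path_using I M x z"
  by (auto simp: has_path_using_def has_path_def)

lemma has_path_using_sym: "has_path_using I M x y \<Longrightarrow> has_path_using I M y x"
proof -
  have "sym ((adj (restrict_colors I M))\<^sup>*)"
    by (rule sym_rtrancl) (auto simp: sym_def adj_def insert_commute)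
  then show "has_path_using I M x y \<Longrightarrow> has_path_using I M y x"
    by (auto simp: has_path_using_def has_path_def dest: symD)
qed

lemma has_path_using_nodes:
  "has_path_using I M x y \<Longrightarrow> x \<in> nodes M \<and> y \<in> nodes M"
  by (auto simp: has_path_using_def has_path_def restrict_colors_def)

lemma has_path_using_nbr:
  assumes "pre_maniplex m M" "x \<in> nodes M" "i < m" "i \<in> I"
  shows "has_path_using I M x (nbr M i x)"
  using nbr_edge[OF assms(1-3)] nbr_in_nodes[OF assms(1-3)] assms
  by (auto simp: has_path_using_def has_path_def restrict_colors_def adj_def intro!: r_into_rtrancl)

text \<open>Every edge has a color below \<open>m\<close>, so each step of the path is a
  \<open>nbr\<close> move and an invariant can be checked color by color.\<close>

lemma has_path_using_induct [consumes 2, case_names refl nbr]: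
  assumes "pre_maniplex m M" "has_path_using I M x y"
    and "Q x"
    and "\<And>z i. z \<in> nodes M \<Longrightarrow> i < m \<Longrightarrow> i \<in> I \<Longrightarrow> Q z \<Longrightarrow> Q (nbr M i z)"
  shows "Q y"
proof -
  have "(x, y) \<in> (adj (restrict_colors I M))\<^sup>*"
    using assms(2) by (auto simp: has_path_using_def has_path_def)
  then show ?thesis
  proof (induction rule: rtrancl_induct)
    case base
    show ?case by fact
  next
    case (step y z)
    then have e: "{y, z} \<in> edges M" "color M {y, z} \<in> I"
      by (auto simp: adj_def restrict_colors_def)
    then have "y \<in> nodes M" "color M {y, z} < m"
      using assms(1) by (auto simp: pre_maniplex_def simple_graph_def)
    then show ?case using assms(4)[OF _ _ e(2) step.IH] nbr_eqI[OF assms(1) e(1)] by simp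
  qed
qed

text \<open>No edge has color \<open>m\<close> or more. This lets the infinite color set that
  defines a facet be traded for the interval in the path intersection property.\<close>

lemma has_path_using_mono:
  assumes "pre_maniplex m M" "has_path_using I M x y" "I \<inter> {..<m} \<subseteq> J"
  shows "has_path_using J M x y"
  using assms(1,2)
proof (induction rule: has_path_using_induct)
  case refl
  show ?case using has_path_using_refl has_path_using_nodes assms(2) by metis
next
  case (nbr z i)
  then have "has_path_using J M z (nbr M i z)"
    using assms(3) by (intro has_path_using_nbr[OF assms(1)]) auto
  with nbr show ?case by (metis has_path_using_trans)
qed

text \<open>The move \<open>nbr M i\<close> is an involution, so the path can only alternate between
  two flags.\<close>

lemma has_path_using_singleton:
  assumes "pre_maniplex m M" "has_path_using {i} M x y"
  shows "y = x \<or> y = nbr M i x"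
  using assms
proof (induction rule: has_path_using_induct)
  case (nbr z j)
  moreover have "x \<in> nodes M" using has_path_using_nodes assms(2) by metis
  ultimately show ?case using nbr_nbr[OF assms(1)] by auto
qed simp

section \<open>Faces\<close>

text \<open>Naming a face by one of its flags turns questions about faces into questions of
  reachability.\<close>

definition face_at :: "nat set \<Rightarrow> 'a colored_graph \<Rightarrow> 'a \<Rightarrow> 'a colored_graph" where
  "face_at I M x = induced_subgraph (restrict_colors I M) {y. has_path_using I M x y}"

lemma faces_eq: "faces i M = face_at {c. int c \<noteq> i} M ` nodes M"
  by (simp add: faces_def components_def face_at_def has_path_using_def restrict_colors_def)

lemma nodes_face_at [simp]: "nodes (face_at I M x) = {y. has_path_using I M x y}"
  by (simp add: face_at_def induced_subgraph_def)

lemma edges_face_at: "edges (face_at I M x) =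
    {e \<in> edges M. color M e \<in> I \<and> e \<subseteq> {y. has_path_using I M x y}}"
  by (auto simp: face_at_def induced_subgraph_def restrict_colors_def)

lemma color_face_at [simp]: "color (face_at I M x) = color M"
  by (simp add: face_at_def induced_subgraph_def restrict_colors_def)

text \<open>A component is determined by its node set, and reachability is an equivalence;
  \<open>y\<close> being a node supplies the trivial path at \<open>y\<close>.\<close>

lemma face_at_eq_iff:
  assumes "y \<in> nodes M"
  shows "face_at I M x = face_at I M y \<longleftrightarrow> has_path_using I M x y"
proof
  assume "face_at I M x = face_at I M y"
  then have "nodes (face_at I M x) = nodes (face_at I M y)" by simp
  then show "has_path_using I M x y" using has_path_using_refl[OF assms, of I] by auto
next
  assume "has_path_using I M x y"
  then have "{z. has_path_using I M x z} = {z. has_path_using I M y z}"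
    by (metis has_path_using_trans has_path_using_sym)
  then show "face_at I M x = face_at I M y" by (simp add: face_at_def)
qed

text \<open>The theorem gives maps from facets to \<open>P\<close>, whereas the coloring of
  \<open>P\<close> needs a map into a facet. Edges must lie within the nodes for
  \<open>inv_into\<close> to undo \<open>f\<close> on them.\<close>

lemma isomorphic_sym:
  assumes "isomorphic G H" "\<And>e. e \<in> edges G \<Longrightarrow> e \<subseteq> nodes G"
  shows "isomorphic H G"
proof -
  obtain f where f: "bij_betw f (nodes G) (nodes H)" "edges H = (\<lambda>e. f ` e) ` edges G"
      "\<And>e. e \<in> edges G \<Longrightarrow> color H (f ` e) = color G e"
    using assms(1) by (auto simp: isomorphic_def)
  let ?g = "inv_into (nodes G) f"
  have g: "?g ` f ` e = e" if "e \<in> edges G" for e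
    using assms(2)[OF that] f(1) by (metis bij_betw_imp_inj_on inv_into_image_cancel)
  have "bij_betw ?g (nodes H) (nodes G)" using f(1) by (rule bij_betw_inv_into)
  moreover have "edges G = (\<lambda>e. ?g ` e) ` edges H"
  proof -
    have "(\<lambda>e. ?g ` e) ` edges H = id ` edges G"
      unfolding f(2) image_comp by (rule image_cong) (simp_all add: g)
    then show ?thesis by simp
  qed
  moreover have "\<forall>e\<in>edges H. color G (?g ` e) = color H e"
    using f g by auto
  ultimately show ?thesis unfolding isomorphic_def by blast
qed

section \<open>Crossing a facet\<close>

abbreviation facet_at :: "nat \<Rightarrow> 'a colored_graph \<Rightarrow> 'a \<Rightarrow> 'a colored_graph" where
  "facet_at n \<equiv> face_at {c. int c \<noteq> int n}"

lemma facets_Suc_eq: "facets (Suc n) M = facet_at n M ` nodes M"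
  by (simp add: facets_def faces_eq)

lemma maniplex_nbr_commute:
  assumes "maniplex m M" "x \<in> nodes M" "i < m" "j < m" "1 < \<bar>int i - int j\<bar>"
  shows "nbr M j (nbr M i x) = nbr M i (nbr M j x)"
  using assms by (auto simp: maniplex_def)

lemma facet_at_nbr:
  assumes "pre_maniplex (n + 1) Q" "x \<in> nodes Q" "i < n"
  shows "facet_at n Q (nbr Q i x) = facet_at n Q x"
proof -
  have "has_path_using {c. int c \<noteq> int n} Q x (nbr Q i x)"
    using assms by (intro has_path_using_nbr[OF assms(1,2)]) auto
  moreover have "nbr Q i x \<in> nodes Q"
    using assms by (intro nbr_in_nodes[OF assms(1,2)]) auto
  ultimately show ?thesis using face_at_eq_iff by metis
qed

text \<open>The common facet gives a path with colors \<open>0..n - 1\<close>, so path intersection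
  leaves a path of color \<open>n - 1\<close> alone.\<close>

lemma same_facet_PIP:
  assumes "polytope (n + 1) Q" "1 \<le> n" "y \<in> nodes Q"
    and "facet_at n Q x = facet_at n Q y" "has_path_using {n - 1..<n + 1} Q x y"
  shows "y = x \<or> y = nbr Q (n - 1) x"
proof -
  have pm: "pre_maniplex (n + 1) Q" using assms(1) by (auto simp: polytope_def maniplex_def)
  have "has_path_using {c. int c \<noteq> int n} Q x y" using assms(3,4) face_at_eq_iff by metis
  then have "has_path_using {0..n - 1} Q x y"
    by (rule has_path_using_mono[OF pm]) auto
  moreover have "x \<in> nodes Q" using has_path_using_nodes assms(5) by metis
  moreover have "path_intersection_property (n + 1) Q" using assms(1) by (simp add: polytope_def)
  moreover have "n - 1 \<le> n - 1 \<and> n - 1 < n + 1" by auto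
  ultimately have "has_path_using {n - 1..n - 1} Q x y"
    using assms(3,5) unfolding path_intersection_property_def by blast
  then show ?thesis using has_path_using_singleton[OF pm] by simp
qed

text \<open>Otherwise the edge of color \<open>n\<close> at \<open>x\<close> would be a loop or
  coincide with the edge of color \<open>n - 1\<close>.\<close>

lemma facet_at_crossing_neq:
  assumes "polytope (n + 1) Q" "1 \<le> n" "x \<in> nodes Q"
  shows "facet_at n Q (nbr Q n x) \<noteq> facet_at n Q x"
proof
  assume eq: "facet_at n Q (nbr Q n x) = facet_at n Q x"
  have pm: "pre_maniplex (n + 1) Q" using assms(1) by (auto simp: polytope_def maniplex_def)
  have "nbr Q n x = x \<or> nbr Q n x = nbr Q (n - 1) x"
    using has_path_using_nbr[OF pm assms(3), of n] nbr_in_nodes[OF pm assms(3)] eq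
    by (intro same_facet_PIP[OF assms(1,2)]) auto
  moreover have "nbr Q n x \<noteq> x" using nbr_neq[OF pm assms(3)] by simp
  moreover have "n < n + 1" "n - 1 < n + 1" "n \<noteq> n - 1" using assms(2) by auto
  ultimately show False using nbr_color_inj[OF pm assms(3)] by metis
qed

text \<open>Color \<open>n\<close> commutes with \<open>i\<close>, so the two crossed flags are
  joined by an edge of color \<open>i < n\<close>, which stays in one facet.\<close>

lemma facet_at_crossing_cong:
  assumes "maniplex (n + 1) Q" "x \<in> nodes Q" "i + 1 < n"
  shows "facet_at n Q (nbr Q n (nbr Q i x)) = facet_at n Q (nbr Q n x)"
proof -
  have pm: "pre_maniplex (n + 1) Q" using assms(1) by (auto simp: maniplex_def)
  have "nbr Q n (nbr Q i x) = nbr Q i (nbr Q n x)"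
    using assms by (intro maniplex_nbr_commute[OF assms(1)]) auto
  then show ?thesis using facet_at_nbr[OF pm nbr_in_nodes[OF pm assms(2)]] assms(3) by simp
qed

section \<open>Commutation of the colors \<open>n - 1\<close> and \<open>n\<close>\<close>

text \<open>Commutation at the single flag \<open>x\<close> spreads over its whole
  \<open>(n-2)\<close>-face.\<close>

lemma commuting_imp_two_facets:
  assumes "maniplex (n + 1) Q" "1 \<le> n" "x \<in> nodes Q"
    and comm: "nbr Q n (nbr Q (n - 1) x) = nbr Q (n - 1) (nbr Q n x)"
    and y: "has_path_using {c. int c \<noteq> int n - 2} Q x y"
  shows "facet_at n Q y \<in> {facet_at n Q x, facet_at n Q (nbr Q n x)}"
proof -
  let ?F = "{facet_at n Q x, facet_at n Q (nbr Q n x)}"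
  have pm: "pre_maniplex (n + 1) Q" using assms(1) by (auto simp: maniplex_def)
  \<comment> \<open>Membership in \<open>?F\<close> is not inductive by itself: the facet across
    color \<open>n\<close> and the commutation are carried along.\<close>
  have "facet_at n Q y \<in> ?F \<and> facet_at n Q (nbr Q n y) \<in> ?F \<and>
      nbr Q n (nbr Q (n - 1) y) = nbr Q (n - 1) (nbr Q n y)"
    using pm y
  proof (induction rule: has_path_using_induct)
    case refl
    show ?case using comm by simp
  next
    case (nbr z i)
    note nn = nbr_in_nodes[OF pm nbr(1)]
    \<comment> \<open>The excluded color is an integer: for \<open>n = 1\<close> it is
      \<open>-1\<close>, and only the last two cases occur.\<close>
    consider "i + 2 < n" | "i = n - 1" | "i = n"
      using nbr(2,3) by fastforce
    then show ?case
    proof cases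
      case 1
      \<comment> \<open>Both \<open>n - 1\<close> and \<open>n\<close> differ from \<open>i\<close>
        by more than 1.\<close>
      have c: "nbr Q j (nbr Q i w) = nbr Q i (nbr Q j w)"
        if "j \<in> {n - 1, n}" "w \<in> nodes Q" for j w
        using that 1 by (intro maniplex_nbr_commute[OF assms(1)]) auto
      have "nbr Q n (nbr Q (n - 1) (nbr Q i z)) = nbr Q (n - 1) (nbr Q n (nbr Q i z))"
        using c nn nbr by simp
      then show ?thesis
        using facet_at_crossing_cong[OF assms(1) nbr(1), of i] facet_at_nbr[OF pm nbr(1), of i] 1 nbr(4)
        by simp
    next
      case 2
      then show ?thesis
        using facet_at_nbr[OF pm nbr(1), of i] facet_at_nbr[OF pm nn, of n i] nbr_nbr[OF pm] nn nbr assms(2)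
        by simp
    next
      case 3
      \<comment> \<open>This move exchanges a flag with the one across, hence the first two parts of
        the invariant.\<close>
      have "nbr Q n (nbr Q n (nbr Q (n - 1) z)) = nbr Q (n - 1) z"
        using nbr_nbr[OF pm nn, of "n - 1" n] by simp
      then show ?thesis using 3 nbr_nbr[OF pm nbr(1), of n] nbr(4) by simp
    qed
  qed
  then show ?thesis by blast
qed

text \<open>Equality would confine the \<open>(n-2)\<close>-face of \<open>x\<close> to two facets,
  while flatness makes it meet at least three.\<close>

lemma flat_crossing_neq:
  assumes "polytope (n + 1) Q" "1 \<le> n" "x \<in> nodes Q"
    and "flat (int n - 2) (int n) Q" "3 \<le> card (facets (n + 1) Q)"
  shows "facet_at n Q (nbr Q n (nbr Q (n - 1) x)) \<noteq> facet_at n Q (nbr Q n x)"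
proof
  let ?u = "nbr Q n x" and ?v = "nbr Q n (nbr Q (n - 1) x)"
  assume eq: "facet_at n Q ?v = facet_at n Q ?u"
  have mx: "maniplex (n + 1) Q" using assms(1) by (auto simp: polytope_def)
  then have pm: "pre_maniplex (n + 1) Q" by (auto simp: maniplex_def)
  note nx = nbr_in_nodes[OF pm assms(3)]
  have nodes: "?u \<in> nodes Q" "?v \<in> nodes Q" "nbr Q (n - 1) x \<in> nodes Q"
    using nx nbr_in_nodes[OF pm nx] by auto
  \<comment> \<open>The path goes from \<open>?u\<close> back to \<open>x\<close>, along color
    \<open>n - 1\<close>, and across to \<open>?v\<close>.\<close>
  have "has_path_using {n - 1..<n + 1} Q ?u ?v"
  proof -
    let ?I = "{n - 1..<n + 1}"
    have "has_path_using ?I Q x ?u" "has_path_using ?I Q x (nbr Q (n - 1) x)"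
        "has_path_using ?I Q (nbr Q (n - 1) x) ?v"
      using assms(3) nodes(3) by (auto intro!: has_path_using_nbr[OF pm])
    then show ?thesis by (metis has_path_using_sym has_path_using_trans)
  qed
  then have "?v = ?u \<or> ?v = nbr Q (n - 1) ?u"
    using eq nodes by (intro same_facet_PIP[OF assms(1,2)]) auto
  moreover have "n < n + 1" "n - 1 < n + 1" by auto
  \<comment> \<open>Crossing back by color \<open>n\<close> would make the edge of color
    \<open>n - 1\<close> at \<open>x\<close> a loop.\<close>
  then have "?v \<noteq> ?u"
    using nbr_nbr[OF pm assms(3)] nbr_nbr[OF pm nodes(3)] nbr_neq[OF pm assms(3)] by metis
  ultimately have comm: "?v = nbr Q (n - 1) ?u" by blast
  have "facets (n + 1) Q \<subseteq> {facet_at n Q x, facet_at n Q ?u}"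
  proof
    fix G assume G: "G \<in> facets (n + 1) Q"
    then have "incident (face_at {c. int c \<noteq> int n - 2} Q x) G"
      using assms(3,4) by (auto simp: flat_def faces_eq facets_def)
    then obtain y where y: "has_path_using {c. int c \<noteq> int n - 2} Q x y" "y \<in> nodes G"
      by (auto simp: incident_def)
    obtain z where z: "G = facet_at n Q z" using G by (auto simp: facets_Suc_eq)
    then have zy: "has_path_using {c. int c \<noteq> int n} Q z y" using y(2) by simp
    then have "y \<in> nodes Q" using has_path_using_nodes by metis
    then have "G = facet_at n Q y" unfolding z using zy by (simp only: face_at_eq_iff)
    then show "G \<in> {facet_at n Q x, facet_at n Q ?u}"
      using commuting_imp_two_facets[OF mx assms(2,3) comm y(1)] by simp
  qed
  then have "card (facets (n + 1) Q) \<le> card {facet_at n Q x, facet_at n Q ?u}"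
    by (intro card_mono) auto
  also have "\<dots> \<le> 2" by (simp add: card_insert_if)
  finally show False using assms(5) by simp
qed

section \<open>The coloring of the facet graph\<close>

text \<open>The facets of \<open>Q\<close> other than \<open>F\<close> serve as colors, hence the
  \<open>- 1\<close>.\<close>

lemma flat_imp_facet_graph_colorable:
  assumes P: "polytope n P" and n: "1 \<le> n" and Q: "polytope (n + 1) Q"
    and k: "3 \<le> card (facets (n + 1) Q)"
    and F: "F \<in> facets (n + 1) Q" "isomorphic F P"
    and fl: "flat (int n - 2) (int n) Q"
  shows "colorable (card (facets (n + 1) Q) - 1) (facet_graph n P)"
proof -
  have mx: "maniplex (n + 1) Q" and pmP: "pre_maniplex n P"
    using P Q by (auto simp: polytope_def maniplex_def)
  then have pm: "pre_maniplex (n + 1) Q" by (auto simp: maniplex_def)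
  obtain x0 where x0: "x0 \<in> nodes Q" "F = facet_at n Q x0"
    using F(1) by (auto simp: facets_Suc_eq)
  have "isomorphic P F"
    using F(2) by (rule isomorphic_sym) (auto simp: x0 edges_face_at)
  then obtain f where f: "bij_betw f (nodes P) (nodes F)" "edges F = (\<lambda>e. f ` e) ` edges P"
      "\<And>e. e \<in> edges P \<Longrightarrow> color F (f ` e) = color P e"
    by (auto simp: isomorphic_def)
  have fF: "f y \<in> nodes Q" "facet_at n Q (f y) = F" if "y \<in> nodes P" for y
  proof -
    have h: "has_path_using {c. int c \<noteq> int n} Q x0 (f y)"
      using bij_betwE[OF f(1)] that by (auto simp: x0)
    then show "f y \<in> nodes Q" using has_path_using_nodes by metis
    then show "facet_at n Q (f y) = F" using h x0 face_at_eq_iff by metis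
  qed
  \<comment> \<open>\<open>f\<close> sends edges of \<open>P\<close> to edges of \<open>F\<close>,
    hence of \<open>Q\<close>, of the same color.\<close>
  have f_nbr: "f (nbr P i y) = nbr Q i (f y)" if "y \<in> nodes P" "i < n" for y i
  proof -
    note e = nbr_edge[OF pmP that]
    have "f ` {y, nbr P i y} \<in> edges F" using e f(2) by blast
    then have "{f y, f (nbr P i y)} \<in> edges Q" by (simp add: x0 edges_face_at)
    moreover have "color Q {f y, f (nbr P i y)} = i" using f(3)[OF e(1)] e(2) by (simp add: x0)
    ultimately show ?thesis using nbr_eqI[OF pm] by metis
  qed
  \<comment> \<open>The color of a flag \<open>y\<close>, as a facet: the one across color
    \<open>n\<close> from the copy of \<open>y\<close> in \<open>F\<close>.\<close>
  define X where "X y = facet_at n Q (nbr Q n (f y))" for y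
  have X_mem: "X y \<in> facets (n + 1) Q - {F}" if "y \<in> nodes P" for y
    using facet_at_crossing_neq[OF Q n fF(1)[OF that]] fF[OF that] nbr_in_nodes[OF pm, of "f y" n]
    by (auto simp: X_def facets_Suc_eq)
  \<comment> \<open>\<open>X\<close> is constant on each facet of \<open>P\<close>, so it descends
    to facets.\<close>
  have X_path: "X y = X x" if "has_path_using {c. int c \<noteq> int n - 1} P x y" for x y
    using pmP that
  proof (induction rule: has_path_using_induct)
    case (nbr z i)
    then have "i + 1 < n" by auto
    then show ?case
      using facet_at_crossing_cong[OF mx fF(1)] f_nbr nbr by (simp add: X_def)
  qed simp
  \<comment> \<open>\<open>card\<close> is 0 on infinite sets, so \<open>k\<close> gives
    finiteness.\<close>
  have "finite (facets (n + 1) Q)" using k by (intro card_ge_0_finite) simp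
  then obtain h where h: "bij_betw h (facets (n + 1) Q - {F}) {0..<card (facets (n + 1) Q - {F})}"
    using ex_bij_betw_finite_nat by blast
  \<comment> \<open>\<open>h\<close> numbers the available facets; by \<open>X_path\<close> the
    chosen flag does not affect the color.\<close>
  define c where "c G = h (X (SOME y. y \<in> nodes G))" for G :: "'a colored_graph"
  have c_eq: "y \<in> nodes P \<and> c G = h (X y)" if G: "G \<in> facets n P" "y \<in> nodes G" for G y
  proof -
    obtain x where x: "G = face_at {c. int c \<noteq> int n - 1} P x"
      using G(1) by (auto simp: facets_def faces_eq)
    have "(SOME y. y \<in> nodes G) \<in> nodes G" using G(2) by (rule someI)
    then have "X (SOME y. y \<in> nodes G) = X y" using x G(2) X_path by fastforce
    moreover have "y \<in> nodes P" using G(2) x has_path_using_nodes by fastforce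
    ultimately show ?thesis by (simp add: c_def)
  qed
  have neq: "c G \<noteq> c H" if "G \<in> facets n P" "H \<in> facets n P" "y \<in> nodes G" "z \<in> nodes H"
      "{y, z} \<in> edges P" "int (color P {y, z}) = int n - 1" for G H y z
  proof
    assume "c G = c H"
    moreover note cy = c_eq[OF that(1,3)] and cz = c_eq[OF that(2,4)]
    ultimately have "X y = X z"
      using bij_betw_imp_inj_on[OF h] X_mem by (metis inj_onD)
    moreover have "color P {y, z} = n - 1" using that(6) n by simp
    then have "z = nbr P (n - 1) y" using nbr_eqI[OF pmP that(5)] by simp
    ultimately show False
      using flat_crossing_neq[OF Q n _ fl k, of "f y"] fF f_nbr[of y "n - 1"] cy n
      by (simp add: X_def)
  qed
  have "c G < card (facets (n + 1) Q) - 1" if G: "G \<in> facets n P" for G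
  proof -
    obtain x where "x \<in> nodes P" "G = face_at {c. int c \<noteq> int n - 1} P x"
      using G by (auto simp: facets_def faces_eq)
    then have "x \<in> nodes P" "c G = h (X x)"
      using c_eq[OF G, of x] has_path_using_refl[of x P] by auto
    then show ?thesis using bij_betwE[OF h] X_mem[of x] F(1) by (auto simp: card_Diff_singleton)
  qed
  moreover have "c G \<noteq> c H" if GH: "{G, H} \<in> edges (facet_graph n P)" for G H
  proof -
    \<comment> \<open>An edge is an unordered pair, so \<open>G'\<close> and \<open>H'\<close> may
      be \<open>G\<close> and \<open>H\<close> in either order.\<close>
    obtain G' H' y z where *: "{G, H} = {G', H'}" "G' \<in> facets n P" "H' \<in> facets n P"
        "y \<in> nodes G'" "z \<in> nodes H'" "{y, z} \<in> edges P" "int (color P {y, z}) = int n - 1"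
      using GH by (auto simp: facet_graph_def)
    have "c G' \<noteq> c H'" using neq *(2-) by blast
    then show ?thesis using *(1) by (auto simp: doubleton_eq_iff)
  qed
  ultimately show ?thesis unfolding colorable_def by (auto simp: facet_graph_def)
qed

theorem corollary3p2:
  fixes k n :: nat and P :: "'a colored_graph"
  assumes "k \<ge> 3" and "n \<ge> 1"
    and "polytope n P"
    and "\<not> colorable (k - 1) (facet_graph n P)"
  shows "\<not> (\<exists>Q :: 'b colored_graph.
      polytope (n + 1) Q \<and>
      card (facets (n + 1) Q) = k \<and>
      (\<forall>F\<in>facets (n + 1) Q. isomorphic F P) \<and>
      flat (int n - 2) (int n) Q)"
proof
  assume "\<exists>Q :: 'b colored_graph.
      polytope (n + 1) Q \<and>
      card (facets (n + 1) Q) = k \<and>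
      (\<forall>F\<in>facets (n + 1) Q. isomorphic F P) \<and>
      flat (int n - 2) (int n) Q"
  then obtain Q :: "'b colored_graph" where Q: "polytope (n + 1) Q"
      "card (facets (n + 1) Q) = k" "\<forall>F\<in>facets (n + 1) Q. isomorphic F P"
      "flat (int n - 2) (int n) Q"
    by blast
  have "facets (n + 1) Q \<noteq> {}" using Q(2) assms(1) by auto
  then obtain F where "F \<in> facets (n + 1) Q" by blast
  then show False
    using flat_imp_facet_graph_colorable[OF assms(3,2) Q(1)] Q assms(1,4) by auto
qed

end
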